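(* Let $\mathbf{X}=(X_1,\ldots,X_N)^T$ be a vector of $N\in\mathbb{N}$ input random variables fulfilling Assumptions A and B (stated in the context), and let $0\le S\le N$, $S\le m<\infty$. Let $$\Pi^N_{S,m}:=\mathbf{1}\oplus\bigoplus_{\substack{\emptyset\neq u\subseteq\{1,\ldots,N\}\\1\le|u|\le S}}\ \bigoplus_{\substack{\mathbf{j}_u\in\mathbb{N}^{|u|}\\|u|\le|\mathbf{j}_u|\le m}}\mathrm{span}\{\Psi_{u,\mathbf{j}_u}(\mathbf{X}_u)\}\subseteq L^2(\Omega,\mathcal{F},\mathbb{P})$$ define the subspace of all polynomials in $\mathbf{X}$ with the degree of interaction at most $S$ and order at most $m$, including constants. Then the $S$-variate, $m$th-order PDD approximation $y_{S,m}(\mathbf{X})$ of $y(\mathbf{X})\in L^2(\Omega,\mathcal{F},\mathbb{P})$ is the best approximation in the sense that $$\mathbb{E}\left[y(\mathbf{X})-y_{S,m}(\mathbf{X})\right]^2=\inf_{\bar y_{S,m}\in\Pi^N_{S,m}}\mathbb{E}\left[y(\mathbf{X})-\bar y_{S,m}(\mathbf{X})\right]^2.$$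
   Context: $\mathbb{N}=\{1,2,\ldots\}$, $\mathbb{N}_0=\mathbb{N}\cup\{0\}$. $(\Omega,\mathcal{F},\mathbb{P})$ is a complete probability space with expectation $\mathbb{E}$; $\mathbf{X}$ takes values in $\mathbb{A}^N=\times_{i=1}^N\mathbb{A}^{\{i\}}$, $\mathbb{A}^{\{i\}}\subseteq\mathbb{R}$. $y(\mathbf{X})$ is a real-valued random variable given by a measurable function $y$ of $\mathbf{X}$ with $\mathbb{E}[y^2(\mathbf{X})]<\infty$. $\mathbb{E}[Z]^2$ applied to a random difference means $\mathbb{E}[Z^2]$. Assumption A: (1) each $X_i$ has an absolutely continuous marginal distribution function and a continuous marginal density $f_{X_i}$ with bounded or unbounded support $\mathbb{A}^{\{i\}}\subseteq\mathbb{R}$; (2) $X_1,\ldots,X_N$ are statistically independent (not necessarily identically distributed), so $\mathbf{X}$ has joint density $f_{\mathbf{X}}(\mathbf{x})=\prod_{i=1}^N f_{X_i}(x_i)$; (3) each $X_i$ has finite moments $\mu_{i,l}=\mathbb{E}[X_i^l]$ of all orders $l\in\mathbb{N}_0$. Assumption B: each $X_i$, $i=1,\ldots,N$, satisfies at least one of: (1) $f_{X_i}$ has compact support, i.e. $\mathbb{P}(a_i\le X_i\le b_i)=1$ for some $a_i,b_i\in\mathbb{R}$; (2) $\liminf_{l\to\infty}(\mu_{i,2l})^{1/2l}/(2l)<\infty$; (3) $\sum_{l\in\mathbb{N}}1/(\mu_{i,2l})^{1/2l}=\infty$; (4) there is a real $a>0$ with $\int_{\mathbb{A}^{\{i\}}}\exp(a|x_i|)f_{X_i}(x_i)dx_i<\infty$;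 (5) $f_{X_i}$ is symmetric, differentiable and strictly positive, and there is a real $a>0$ such that $\int_{\mathbb{A}^{\{i\}}}-\frac{\ln f_{X_i}(x_i)}{1+x_i^2}dx_i=\infty$ and $\frac{-x_i\,df_{X_i}(x_i)/dx_i}{f_{X_i}(x_i)}\to\infty$ as $x_i\to\infty$, $x_i\ge a$. For each $i$, $\{P_{\{i\},j}: j\in\mathbb{N}_0\}$ is a set of univariate orthogonal polynomials for $f_{X_i}dx_i$: nonzero real polynomials, $P_{\{i\},j}$ of degree $j$, with $\mathbb{E}[P_{\{i\},j}(X_i)P_{\{i\},k}(X_i)]=0$ for $j\neq k$ and $0<\mathbb{E}[P_{\{i\},j}^2(X_i)]<\infty$; $\Psi_{\{i\},j}=P_{\{i\},j}/\sqrt{\mathbb{E}[P_{\{i\},j}^2(X_i)]}$. For $\emptyset\ne u=\{i_1,\ldots,i_{|u|}\}\subseteq\{1,\ldots,N\}$ and $\mathbf{j}_u=(j_{i_1},\ldots,j_{i_{|u|}})\in\mathbb{N}^{|u|}$ with $|\mathbf{j}_u|=j_{i_1}+\cdots+j_{i_{|u|}}$, $\Psi_{u,\mathbf{j}_u}(\mathbf{x}_u)=\prod_{i\in u}\Psi_{\{i\},j_i}(x_i)$. $\mathbf{1}=\mathrm{span}\{1\}$ is the space of constants. The $S$-variate, $m$th-order PDD (polynomial dimensional decomposition) approximation of $y(\mathbf{X})$ is $$y_{S,m}(\mathbf{X})=y_\emptyset+\sum_{\substack{\emptyset\neq u\subseteq\{1,\ldots,N\}\\1\le|u|\le S}}\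 \sum_{\substack{\mathbf{j}_u\in\mathbb{N}^{|u|}\\|u|\le|\mathbf{j}_u|\le m}}C_{u,\mathbf{j}_u}\Psi_{u,\mathbf{j}_u}(\mathbf{X}_u),\quad y_\emptyset=\mathbb{E}[y(\mathbf{X})],\quad C_{u,\mathbf{j}_u}=\mathbb{E}[y(\mathbf{X})\Psi_{u,\mathbf{j}_u}(\mathbf{X}_u)].$$ *)

theory Defs
  imports
    "HOL-Probability.Probability"
    "HOL-Computational_Algebra.Polynomial"
    "HOL-Library.Function_Algebras"
begin

text \<open>
  The coordinates of the input vector are indexed by \<open>{1..N}\<close>. The functions \<open>f i\<close> are defined on
  the whole line and vanish off \<open>A i\<close>.
\<close>

definition moment :: "'w measure \<Rightarrow> (nat \<Rightarrow> 'w \<Rightarrow> real) \<Rightarrow> nat \<Rightarrow> nat \<Rightarrow> real" where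
  "moment M X i l = (\<integral>\<omega>. X i \<omega> ^ l \<partial>M)"

text \<open>
  Absolute continuity of the distribution function of \<open>X i\<close> is expressed by the existence of a
  Lebesgue density. The density need only be continuous on its support, so that for instance
  uniform and exponential variables are included. The support may be taken open, closed, or
  anything in between.
\<close>

definition assumption_A ::
  "'w measure \<Rightarrow> nat \<Rightarrow> (nat \<Rightarrow> 'w \<Rightarrow> real) \<Rightarrow> (nat \<Rightarrow> real set) \<Rightarrow> (nat \<Rightarrow> real \<Rightarrow> real) \<Rightarrow> bool" where
  "assumption_A M N X A f \<longleftrightarrow>
    (\<forall>i\<in>{1..N}.
        distributed M lborel (X i) (\<lambda>x. ennreal (f i x)) \<and>
        (\<forall>x. 0 \<le> f i x) \<and>
        A i \<in> sets borel \<and>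
        {x. f i x \<noteq> 0} \<subseteq> A i \<and> A i \<subseteq> closure {x. f i x \<noteq> 0} \<and>
        continuous_on (A i) (f i)) \<and>
    prob_space.indep_vars M (\<lambda>_. borel) X {1..N} \<and>
    (\<forall>i\<in>{1..N}. \<forall>l. integrable M (\<lambda>\<omega>. X i \<omega> ^ l))"

definition bounded_range :: "'w measure \<Rightarrow> (nat \<Rightarrow> 'w \<Rightarrow> real) \<Rightarrow> nat \<Rightarrow> bool" where
  "bounded_range M X i \<longleftrightarrow>
    (\<exists>a b. measure M {\<omega> \<in> space M. a \<le> X i \<omega> \<and> X i \<omega> \<le> b} = 1)"

definition moment_growth :: "'w measure \<Rightarrow> (nat \<Rightarrow> 'w \<Rightarrow> real) \<Rightarrow> nat \<Rightarrow> bool" where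
  "moment_growth M X i \<longleftrightarrow>
    liminf (\<lambda>l. ereal (root (2 * l) (moment M X i (2 * l)) / (2 * real l))) < \<infinity>"

text \<open>The series runs over \<open>l \<ge> 1\<close>, hence the shift to \<open>Suc l\<close>.\<close>

definition carleman :: "'w measure \<Rightarrow> (nat \<Rightarrow> 'w \<Rightarrow> real) \<Rightarrow> nat \<Rightarrow> bool" where
  "carleman M X i \<longleftrightarrow>
    (\<Sum>l. ereal (1 / root (2 * Suc l) (moment M X i (2 * Suc l)))) = \<infinity>"

definition exp_integrable :: "(nat \<Rightarrow> real set) \<Rightarrow> (nat \<Rightarrow> real \<Rightarrow> real) \<Rightarrow> nat \<Rightarrow> bool" where
  "exp_integrable A f i \<longleftrightarrow>
    (\<exists>a>0. (\<integral>\<^sup>+x\<in>A i. ennreal (exp (a * \<bar>x\<bar>) * f i x) \<partial>lborel) < \<infinity>)"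

text \<open>
  Truncating the negative part of the integrand \<open>- ln (f i x) / (1 + x\<^sup>2)\<close> (through \<open>ennreal\<close>) does not
  affect divergence of the integral: \<open>max 0 (ln t) \<le> t\<close> and \<open>f i\<close> is a probability density, so that
  the negative part has a finite integral.
\<close>

definition log_divergent :: "(nat \<Rightarrow> real set) \<Rightarrow> (nat \<Rightarrow> real \<Rightarrow> real) \<Rightarrow> nat \<Rightarrow> bool" where
  "log_divergent A f i \<longleftrightarrow>
    (\<forall>x. f i (- x) = f i x) \<and>
    (\<forall>x\<in>A i. 0 < f i x) \<and>
    (\<exists>f'. (\<forall>x\<in>A i. (f i has_real_derivative f' x) (at x within A i)) \<and>
      (\<exists>a>0.
        (\<integral>\<^sup>+x\<in>A i. ennreal (- ln (f i x) / (1 + x\<^sup>2)) \<partial>lborel) = \<infinity> \<and>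
        filterlim (\<lambda>x. - x * f' x / f i x) at_top (inf at_top (principal {x \<in> A i. a \<le> x}))))"

definition assumption_B ::
  "'w measure \<Rightarrow> nat \<Rightarrow> (nat \<Rightarrow> 'w \<Rightarrow> real) \<Rightarrow> (nat \<Rightarrow> real set) \<Rightarrow> (nat \<Rightarrow> real \<Rightarrow> real) \<Rightarrow> bool" where
  "assumption_B M N X A f \<longleftrightarrow>
    (\<forall>i\<in>{1..N}. bounded_range M X i \<or> moment_growth M X i \<or> carleman M X i \<or>
       exp_integrable A f i \<or> log_divergent A f i)"

definition orthogonal_polys ::
  "'w measure \<Rightarrow> nat \<Rightarrow> (nat \<Rightarrow> 'w \<Rightarrow> real) \<Rightarrow> (nat \<Rightarrow> nat \<Rightarrow> real poly) \<Rightarrow> bool" where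
  "orthogonal_polys M N X P \<longleftrightarrow>
    (\<forall>i\<in>{1..N}.
      (\<forall>j. P i j \<noteq> 0 \<and> degree (P i j) = j \<and>
           integrable M (\<lambda>\<omega>. (poly (P i j) (X i \<omega>))\<^sup>2) \<and>
           0 < (\<integral>\<omega>. (poly (P i j) (X i \<omega>))\<^sup>2 \<partial>M)) \<and>
      (\<forall>j k. j \<noteq> k \<longrightarrow> (\<integral>\<omega>. poly (P i j) (X i \<omega>) * poly (P i k) (X i \<omega>) \<partial>M) = 0))"

definition Psi1 ::
  "'w measure \<Rightarrow> (nat \<Rightarrow> 'w \<Rightarrow> real) \<Rightarrow> (nat \<Rightarrow> nat \<Rightarrow> real poly) \<Rightarrow> nat \<Rightarrow> nat \<Rightarrow> real \<Rightarrow> real" where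
  "Psi1 M X P i j x = poly (P i j) x / sqrt (\<integral>\<omega>. (poly (P i j) (X i \<omega>))\<^sup>2 \<partial>M)"

text \<open>The random variable \<open>\<Psi>\<^sub>u\<^sub>,\<^sub>j(X\<^sub>u)\<close>.\<close>

definition Psi ::
  "'w measure \<Rightarrow> (nat \<Rightarrow> 'w \<Rightarrow> real) \<Rightarrow> (nat \<Rightarrow> nat \<Rightarrow> real poly) \<Rightarrow>
   nat set \<Rightarrow> (nat \<Rightarrow> nat) \<Rightarrow> 'w \<Rightarrow> real" where
  "Psi M X P u j \<omega> = (\<Prod>i\<in>u. Psi1 M X P i (j i) (X i \<omega>))"

definition PDD_sets :: "nat \<Rightarrow> nat \<Rightarrow> nat set set" where
  "PDD_sets N S = {u. u \<noteq> {} \<and> u \<subseteq> {1..N} \<and> 1 \<le> card u \<and> card u \<le> S}"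

text \<open>
  A multi-index for \<open>u\<close> is a function with positive values on \<open>u\<close>; extensionality (\<open>undefined\<close> off \<open>u\<close>)
  makes each multi-index occur exactly once.
\<close>

definition PDD_multis :: "nat \<Rightarrow> nat set \<Rightarrow> (nat \<Rightarrow> nat) set" where
  "PDD_multis m u = {j \<in> u \<rightarrow>\<^sub>E {1..}. card u \<le> sum j u \<and> sum j u \<le> m}"

lemma finite_PDD_sets: "finite (PDD_sets N S)"
  by (rule finite_subset[of _ "Pow {1..N}"]) (auto simp: PDD_sets_def)

lemma finite_PDD_multis:
  assumes "finite u"
  shows "finite (PDD_multis m u)"
proof (rule finite_subset)
  show "PDD_multis m u \<subseteq> u \<rightarrow>\<^sub>E {1..m}"
  proof
    fix j assume "j \<in> PDD_multis m u"
    then have j: "j \<in> u \<rightarrow>\<^sub>E {1..}" and s: "sum j u \<le> m"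
      by (auto simp: PDD_multis_def)
    have "j i \<le> m" if "i \<in> u" for i
      using member_le_sum[of i u j] that assms s by simp
    with j show "j \<in> u \<rightarrow>\<^sub>E {1..m}"
      by (auto simp: PiE_iff)
  qed
  show "finite (u \<rightarrow>\<^sub>E {1..m})"
    using assms by (intro finite_PiE) auto
qed

definition input_vec :: "nat \<Rightarrow> (nat \<Rightarrow> 'w \<Rightarrow> real) \<Rightarrow> 'w \<Rightarrow> (nat \<Rightarrow> real)" where
  "input_vec N X \<omega> = (\<lambda>i\<in>{1..N}. X i \<omega>)"

definition PDD_coeff ::
  "'w measure \<Rightarrow> (nat \<Rightarrow> 'w \<Rightarrow> real) \<Rightarrow> (nat \<Rightarrow> nat \<Rightarrow> real poly) \<Rightarrow> ('w \<Rightarrow> real) \<Rightarrow>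
   nat set \<Rightarrow> (nat \<Rightarrow> nat) \<Rightarrow> real" where
  "PDD_coeff M X P Y u j = (\<integral>\<omega>. Y \<omega> * Psi M X P u j \<omega> \<partial>M)"

definition PDD_approx ::
  "'w measure \<Rightarrow> nat \<Rightarrow> (nat \<Rightarrow> 'w \<Rightarrow> real) \<Rightarrow> (nat \<Rightarrow> nat \<Rightarrow> real poly) \<Rightarrow> nat \<Rightarrow> nat \<Rightarrow>
   ('w \<Rightarrow> real) \<Rightarrow> 'w \<Rightarrow> real" where
  "PDD_approx M N X P S m Y \<omega> =
    (\<integral>\<omega>'. Y \<omega>' \<partial>M) +
    (\<Sum>u\<in>PDD_sets N S. \<Sum>j\<in>PDD_multis m u. PDD_coeff M X P Y u j * Psi M X P u j \<omega>)"

text \<open>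
  Elements of \<open>L\<^sup>2\<close> are represented by square-integrable functions; equality in \<open>L\<^sup>2\<close> is equality
  almost everywhere.
\<close>

definition L2 :: "'w measure \<Rightarrow> ('w \<Rightarrow> real) set" where
  "L2 M = {g \<in> borel_measurable M. integrable M (\<lambda>\<omega>. (g \<omega>)\<^sup>2)}"

interpretation rfun: vector_space "\<lambda>(c::real) (g::'w \<Rightarrow> real) \<omega>. c * g \<omega>"
  by unfold_locales (auto simp: fun_eq_iff algebra_simps)

text \<open>
  The polynomial space as a sum of lines. That the sum is direct in \<open>L\<^sup>2\<close>, i.e.\ that the zero
  element of \<open>L\<^sup>2\<close> only decomposes trivially, is the separate predicate \<open>PDD_sum_direct\<close>.
\<close>

definition PDD_space ::
  "'w measure \<Rightarrow> nat \<Rightarrow> (nat \<Rightarrow> 'w \<Rightarrow> real) \<Rightarrow> (nat \<Rightarrow> nat \<Rightarrow> real poly) \<Rightarrow> nat \<Rightarrow> nat \<Rightarrow>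
   ('w \<Rightarrow> real) set" where
  "PDD_space M N X P S m =
    {v0 + (\<Sum>u\<in>PDD_sets N S. \<Sum>j\<in>PDD_multis m u. v u j) | v0 v.
       v0 \<in> rfun.span {\<lambda>_. 1} \<and>
       (\<forall>u\<in>PDD_sets N S. \<forall>j\<in>PDD_multis m u. v u j \<in> rfun.span {Psi M X P u j})}"

definition PDD_sum_direct ::
  "'w measure \<Rightarrow> nat \<Rightarrow> (nat \<Rightarrow> 'w \<Rightarrow> real) \<Rightarrow> (nat \<Rightarrow> nat \<Rightarrow> real poly) \<Rightarrow> nat \<Rightarrow> nat \<Rightarrow> bool" where
  "PDD_sum_direct M N X P S m \<longleftrightarrow>
    (\<forall>v0 v.
       v0 \<in> rfun.span {\<lambda>_. 1} \<longrightarrow>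
       (\<forall>u\<in>PDD_sets N S. \<forall>j\<in>PDD_multis m u. v u j \<in> rfun.span {Psi M X P u j}) \<longrightarrow>
       (AE \<omega> in M. (v0 + (\<Sum>u\<in>PDD_sets N S. \<Sum>j\<in>PDD_multis m u. v u j)) \<omega> = 0) \<longrightarrow>
       (AE \<omega> in M. v0 \<omega> = 0) \<and>
       (\<forall>u\<in>PDD_sets N S. \<forall>j\<in>PDD_multis m u. AE \<omega> in M. v u j \<omega> = 0))"

end

theory Submission
  imports Defs
begin

text \<open>
  The products \<open>\<Psi>\<^sub>u\<^sub>,\<^sub>j(X\<^sub>u)\<close>, together with the constant \<open>1\<close>, form a finite orthonormal family in
  \<open>L\<^sup>2\<close>: by independence the inner product of two of them factors into univariate inner products, and
  distinct labels differ in some coordinate, whose factor is then zero. This step is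
  \<open>integral_Psi_times_Psi\<close>; the constant is treated as the member \<open>\<Psi>\<^sub>\<emptyset>\<close>, an empty product, so that no
  inner product needs a separate case.

  For a finite orthonormal family \<open>e\<close> with Fourier coefficients \<open>a\<^sub>k = \<langle>Y, e\<^sub>k\<rangle>\<close>, completing the
  square gives
  \<open>\<parallel>Y - (\<Sum>k. c\<^sub>k e\<^sub>k)\<parallel>\<^sup>2 = \<parallel>Y\<parallel>\<^sup>2 - (\<Sum>k. a\<^sub>k\<^sup>2) + (\<Sum>k. (c\<^sub>k - a\<^sub>k)\<^sup>2)\<close>
  (\<open>orthonormal_family_distance\<close>). The right-hand side is smallest at \<open>c = a\<close>, which is the PDD
  approximation, so the infimum is a minimum attained there. The same identity with \<open>Y = 0\<close> is
  Parseval's: a combination that vanishes almost everywhere has only zero coefficients, hence the sum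
  of lines is direct.
\<close>

section \<open>Finite orthonormal families\<close>

lemma L2_mult_integrable:
  assumes "g \<in> L2 M" "h \<in> L2 M"
  shows "integrable M (\<lambda>\<omega>. g \<omega> * h \<omega>)"
proof (rule Bochner_Integration.integrable_bound)
  show "integrable M (\<lambda>\<omega>. (g \<omega>)\<^sup>2 + (h \<omega>)\<^sup>2)"
    and "(\<lambda>\<omega>. g \<omega> * h \<omega>) \<in> borel_measurable M"
    using assms by (auto simp: L2_def)
  have "\<bar>s * t\<bar> \<le> s\<^sup>2 + t\<^sup>2" for s t :: real
  proof -
    have "2 * (\<bar>s\<bar> * \<bar>t\<bar>) \<le> s\<^sup>2 + t\<^sup>2"
      using sum_squares_bound[of "\<bar>s\<bar>" "\<bar>t\<bar>"] by (simp add: mult.assoc)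
    moreover have "0 \<le> \<bar>s\<bar> * \<bar>t\<bar>"
      by simp
    ultimately show ?thesis
      unfolding abs_mult by linarith
  qed
  then show "AE \<omega> in M. norm (g \<omega> * h \<omega>) \<le> norm ((g \<omega>)\<^sup>2 + (h \<omega>)\<^sup>2)"
    by simp
qed

definition orthonormal_family :: "'w measure \<Rightarrow> ('k \<Rightarrow> 'w \<Rightarrow> real) \<Rightarrow> 'k set \<Rightarrow> bool" where
  "orthonormal_family M e K \<longleftrightarrow>
    (\<forall>k\<in>K. e k \<in> L2 M) \<and>
    (\<forall>k\<in>K. \<forall>l\<in>K. (\<integral>\<omega>. e k \<omega> * e l \<omega> \<partial>M) = of_bool (k = l))"

text \<open>Adding a term to a sum adds a cross term to its square, integrable by \<open>L2_mult_integrable\<close>.\<close>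

lemma L2_sum:
  assumes "finite K" "\<And>k. k \<in> K \<Longrightarrow> e k \<in> L2 M"
  shows "(\<lambda>\<omega>. \<Sum>k\<in>K. c k * e k \<omega>) \<in> L2 M"
  using assms
proof (induction K rule: finite_induct)
  case empty
  then show ?case by (simp add: L2_def)
next
  case (insert k K)
  then have s: "(\<lambda>\<omega>. \<Sum>k\<in>K. c k * e k \<omega>) \<in> L2 M" and "e k \<in> L2 M"
    by auto
  then have k: "(\<lambda>\<omega>. c k * e k \<omega>) \<in> L2 M"
    by (auto simp: L2_def power_mult_distrib)
  have meas: "(\<lambda>\<omega>. c k * e k \<omega>) \<in> borel_measurable M"
      "(\<lambda>\<omega>. \<Sum>k\<in>K. c k * e k \<omega>) \<in> borel_measurable M"
    and sq: "integrable M (\<lambda>\<omega>. (c k * e k \<omega>)\<^sup>2)"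
      "integrable M (\<lambda>\<omega>. (\<Sum>k\<in>K. c k * e k \<omega>)\<^sup>2)"
    using k s unfolding L2_def by blast+
  have "integrable M (\<lambda>\<omega>. (c k * e k \<omega> + (\<Sum>k\<in>K. c k * e k \<omega>))\<^sup>2)"
    unfolding power2_sum mult.assoc[of 2]
    by (intro Bochner_Integration.integrable_add integrable_mult_right sq L2_mult_integrable[OF k s])
  moreover have "(\<lambda>\<omega>. c k * e k \<omega> + (\<Sum>k\<in>K. c k * e k \<omega>)) \<in> borel_measurable M"
    using meas by (rule borel_measurable_add)
  ultimately show ?case
    using insert.hyps unfolding L2_def by simp
qed

text \<open>
  Expanding the square, orthonormality leaves \<open>\<parallel>Y\<parallel>\<^sup>2 - 2 (\<Sum>k. c\<^sub>k a\<^sub>k) + (\<Sum>k. c\<^sub>k\<^sup>2)\<close>; completing each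
  square in \<open>c\<^sub>k\<close> isolates the dependence on the coefficients in a sum of squares.
\<close>

lemma orthonormal_family_distance:
  fixes c :: "'k \<Rightarrow> real"
  assumes on: "orthonormal_family M e K" and K: "finite K" and Y: "Y \<in> L2 M"
  defines "a \<equiv> \<lambda>k. \<integral>\<omega>. Y \<omega> * e k \<omega> \<partial>M"
  shows "(\<integral>\<omega>. (Y \<omega> - (\<Sum>k\<in>K. c k * e k \<omega>))\<^sup>2 \<partial>M) =
    (\<integral>\<omega>. (Y \<omega>)\<^sup>2 \<partial>M) - (\<Sum>k\<in>K. (a k)\<^sup>2) + (\<Sum>k\<in>K. (c k - a k)\<^sup>2)"
proof -
  have e: "e k \<in> L2 M" if "k \<in> K" for k
    using on that by (auto simp: orthonormal_family_def)
  have ee: "(\<integral>\<omega>. e k \<omega> * e l \<omega> \<partial>M) = of_bool (k = l)" if "k \<in> K" "l \<in> K" for k l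
    using on that by (auto simp: orthonormal_family_def)
  let ?s = "\<lambda>\<omega>. \<Sum>k\<in>K. c k * e k \<omega>"
  have iY: "integrable M (\<lambda>\<omega>. (Y \<omega>)\<^sup>2)"
    using Y by (simp add: L2_def)
  have iYe: "integrable M (\<lambda>\<omega>. Y \<omega> * e k \<omega>)" if "k \<in> K" for k
    using L2_mult_integrable[OF Y e[OF that]] .
  have iee: "integrable M (\<lambda>\<omega>. e k \<omega> * e l \<omega>)" if "k \<in> K" "l \<in> K" for k l
    using L2_mult_integrable[OF e e] that by blast
  have iYs: "integrable M (\<lambda>\<omega>. \<Sum>k\<in>K. c k * (Y \<omega> * e k \<omega>))"
    by (intro Bochner_Integration.integrable_sum integrable_mult_right iYe)
  have iss: "integrable M (\<lambda>\<omega>. \<Sum>k\<in>K. \<Sum>l\<in>K. c k * c l * (e k \<omega> * e l \<omega>))"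
    by (intro Bochner_Integration.integrable_sum integrable_mult_right iee)
  have expand: "(Y \<omega> - ?s \<omega>)\<^sup>2 = ((Y \<omega>)\<^sup>2 - 2 * (\<Sum>k\<in>K. c k * (Y \<omega> * e k \<omega>)))
      + (\<Sum>k\<in>K. \<Sum>l\<in>K. c k * c l * (e k \<omega> * e l \<omega>))" for \<omega>
  proof -
    have "(?s \<omega>)\<^sup>2 = (\<Sum>k\<in>K. \<Sum>l\<in>K. c k * c l * (e k \<omega> * e l \<omega>))"
      by (simp add: power2_eq_square sum_product mult_ac)
    moreover have "Y \<omega> * ?s \<omega> = (\<Sum>k\<in>K. c k * (Y \<omega> * e k \<omega>))"
      by (simp add: sum_distrib_left mult_ac)
    ultimately show ?thesis
      unfolding power2_diff by (simp add: mult.assoc)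
  qed
  have "(\<integral>\<omega>. (Y \<omega> - ?s \<omega>)\<^sup>2 \<partial>M) =
      (\<integral>\<omega>. (Y \<omega>)\<^sup>2 \<partial>M) - 2 * (\<integral>\<omega>. (\<Sum>k\<in>K. c k * (Y \<omega> * e k \<omega>)) \<partial>M)
      + (\<integral>\<omega>. (\<Sum>k\<in>K. \<Sum>l\<in>K. c k * c l * (e k \<omega> * e l \<omega>)) \<partial>M)"
    unfolding expand using iY iYs iss by simp
  also have "(\<integral>\<omega>. (\<Sum>k\<in>K. c k * (Y \<omega> * e k \<omega>)) \<partial>M) = (\<Sum>k\<in>K. c k * a k)"
    using iYe by (simp add: a_def Bochner_Integration.integral_sum)
  also have "(\<integral>\<omega>. (\<Sum>k\<in>K. \<Sum>l\<in>K. c k * c l * (e k \<omega> * e l \<omega>)) \<partial>M) =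
      (\<Sum>k\<in>K. \<Sum>l\<in>K. c k * c l * (\<integral>\<omega>. e k \<omega> * e l \<omega> \<partial>M))"
    using iee by (simp add: Bochner_Integration.integral_sum)
  also have "\<dots> = (\<Sum>k\<in>K. \<Sum>l\<in>K. if k = l then (c k)\<^sup>2 else 0)"
    by (intro sum.cong refl) (simp add: ee power2_eq_square)
  also have "\<dots> = (\<Sum>k\<in>K. (c k)\<^sup>2)"
    using K by simp
  finally show ?thesis
    by (simp add: power2_diff sum.distrib sum_subtractf sum_distrib_left mult_ac)
qed

lemma orthonormal_family_best_approximation:
  assumes "orthonormal_family M e K" "finite K" "Y \<in> L2 M"
  shows "(\<integral>\<omega>. (Y \<omega> - (\<Sum>k\<in>K. (\<integral>\<omega>'. Y \<omega>' * e k \<omega>' \<partial>M) * e k \<omega>))\<^sup>2 \<partial>M)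
    \<le> (\<integral>\<omega>. (Y \<omega> - (\<Sum>k\<in>K. c k * e k \<omega>))\<^sup>2 \<partial>M)"
  unfolding orthonormal_family_distance[OF assms] by (simp add: sum_nonneg)

text \<open>
  Approximating the zero function, \<open>orthonormal_family_distance\<close> is Parseval's identity: the squared
  norm of a combination is the sum of the squares of its coefficients.
\<close>

lemma orthonormal_family_independent:
  assumes on: "orthonormal_family M e K" and K: "finite K"
    and zero: "AE \<omega> in M. (\<Sum>k\<in>K. c k * e k \<omega>) = 0" and k: "k \<in> K"
  shows "c k = 0"
proof -
  have "(\<integral>\<omega>. (0 - (\<Sum>k\<in>K. c k * e k \<omega>))\<^sup>2 \<partial>M) = (\<Sum>k\<in>K. (c k)\<^sup>2)"
    using orthonormal_family_distance[OF on K, of "\<lambda>_. 0" c] by (simp add: L2_def)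
  moreover have "(\<integral>\<omega>. (0 - (\<Sum>k\<in>K. c k * e k \<omega>))\<^sup>2 \<partial>M) = 0"
    using zero by (intro integral_eq_zero_AE) auto
  ultimately have "(\<Sum>k\<in>K. (c k)\<^sup>2) = 0"
    by simp
  with K k show ?thesis
    by (simp add: sum_nonneg_eq_0_iff)
qed

section \<open>Orthonormality of the multivariate polynomials\<close>

lemma Psi1_in_L2:
  assumes "orthogonal_polys M N X P" "i \<in> {1..N}" "X i \<in> borel_measurable M"
  shows "(\<lambda>\<omega>. Psi1 M X P i j (X i \<omega>)) \<in> L2 M"
proof -
  have [measurable]: "X i \<in> borel_measurable M"
    by (fact assms)
  have "(\<lambda>\<omega>. poly (P i j) (X i \<omega>)) \<in> borel_measurable M"
    unfolding poly_altdef by measurable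
  with assms show ?thesis
    by (auto simp: L2_def Psi1_def orthogonal_polys_def power_divide)
qed

lemma integral_Psi1_times_Psi1:
  assumes "orthogonal_polys M N X P" "i \<in> {1..N}"
  shows "(\<integral>\<omega>. Psi1 M X P i j (X i \<omega>) * Psi1 M X P i k (X i \<omega>) \<partial>M) = of_bool (j = k)"
proof -
  have pos: "0 < (\<integral>\<omega>. (poly (P i j) (X i \<omega>))\<^sup>2 \<partial>M)"
    using assms by (auto simp: orthogonal_polys_def)
  show ?thesis
  proof (cases "j = k")
    case True
    have "(\<integral>\<omega>. Psi1 M X P i j (X i \<omega>) * Psi1 M X P i k (X i \<omega>) \<partial>M) =
        (\<integral>\<omega>. (poly (P i j) (X i \<omega>))\<^sup>2 / (\<integral>\<omega>. (poly (P i j) (X i \<omega>))\<^sup>2 \<partial>M) \<partial>M)"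
      using pos by (simp add: True Psi1_def power2_eq_square)
    with pos True show ?thesis
      by simp
  next
    case False
    with assms show ?thesis
      by (simp add: Psi1_def orthogonal_polys_def)
  qed
qed

text \<open>The polynomial of degree \<open>0\<close> is a nonzero constant, so orthogonality to it is a zero mean.\<close>

lemma integral_Psi1:
  assumes op: "orthogonal_polys M N X P" and i: "i \<in> {1..N}" and j: "1 \<le> j"
  shows "(\<integral>\<omega>. Psi1 M X P i j (X i \<omega>) \<partial>M) = 0"
proof -
  have "P i 0 \<noteq> 0" "degree (P i 0) = 0"
    using op i by (auto simp: orthogonal_polys_def)
  then obtain c where c: "P i 0 = [:c:]" "c \<noteq> 0"
    by (metis degree_eq_zeroE pCons_0_0)
  have "(\<integral>\<omega>. poly (P i j) (X i \<omega>) * poly (P i 0) (X i \<omega>) \<partial>M) = 0"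
    using op i j by (auto simp: orthogonal_polys_def)
  with c show ?thesis
    by (simp add: Psi1_def)
qed

text \<open>
  Both products are extended to all of \<open>{1..N}\<close> by factors \<open>1\<close>, so that independence turns their inner
  product into a product over coordinates. If \<open>u \<noteq> v\<close>, a coordinate in exactly one of them contributes
  the mean of a polynomial of positive degree; if \<open>u = v\<close> and \<open>j \<noteq> k\<close>, a coordinate with
  \<open>j i \<noteq> k i\<close> contributes the inner product of two different orthogonal polynomials.
\<close>

lemma (in prob_space) integral_Psi_times_Psi:
  assumes op: "orthogonal_polys M N X P" and ind: "indep_vars (\<lambda>_. borel) X {1..N}"
    and u: "u \<subseteq> {1..N}" "j \<in> u \<rightarrow>\<^sub>E {1..}" and v: "v \<subseteq> {1..N}" "k \<in> v \<rightarrow>\<^sub>E {1..}"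
  shows "integrable M (\<lambda>\<omega>. Psi M X P u j \<omega> * Psi M X P v k \<omega>)"
    and "(\<integral>\<omega>. Psi M X P u j \<omega> * Psi M X P v k \<omega> \<partial>M) = of_bool ((u, j) = (v, k))"
proof -
  define g where "g w l i x = (if i \<in> w then Psi1 M X P i (l i) x else 1)" for w l i x
  define h where "h i x = g u j i x * g v k i x" for i x
  have rv: "X i \<in> borel_measurable M" if "i \<in> {1..N}" for i
    using ind that by (auto simp: indep_vars_def)
  have gL2: "(\<lambda>\<omega>. g w l i (X i \<omega>)) \<in> L2 M" if "i \<in> {1..N}" for w l i
  proof (cases "i \<in> w")
    case True
    then show ?thesis
      using Psi1_in_L2[OF op that rv[OF that]] by (simp add: g_def)
  qed (simp add: g_def L2_def)
  have Psi_g: "Psi M X P w l \<omega> = (\<Prod>i\<in>{1..N}. g w l i (X i \<omega>))" if "w \<subseteq> {1..N}" for w l \<omega>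
    unfolding Psi_def g_def using that
    by (simp add: prod.If_cases Int_absorb1)
  have prod_h: "Psi M X P u j \<omega> * Psi M X P v k \<omega> = (\<Prod>i\<in>{1..N}. h i (X i \<omega>))" for \<omega>
    unfolding Psi_g[OF u(1)] Psi_g[OF v(1)] h_def prod.distrib ..
  have hint: "integrable M (\<lambda>\<omega>. h i (X i \<omega>))" if "i \<in> {1..N}" for i
    unfolding h_def using L2_mult_integrable[OF gL2 gL2] that by blast
  have "h i \<in> borel_measurable borel" for i
    unfolding h_def g_def Psi1_def poly_altdef by measurable
  with ind have hind: "indep_vars (\<lambda>_. borel) (\<lambda>i \<omega>. h i (X i \<omega>)) {1..N}"
    by (rule indep_vars_compose2)
  show "integrable M (\<lambda>\<omega>. Psi M X P u j \<omega> * Psi M X P v k \<omega>)"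
    unfolding prod_h by (intro indep_vars_integrable hind hint) auto
  have factor: "(\<integral>\<omega>. Psi M X P u j \<omega> * Psi M X P v k \<omega> \<partial>M) =
      (\<Prod>i\<in>{1..N}. \<integral>\<omega>. h i (X i \<omega>) \<partial>M)"
    unfolding prod_h by (intro indep_vars_lebesgue_integral hind hint) auto
  have both: "(\<integral>\<omega>. h i (X i \<omega>) \<partial>M) = of_bool (j i = k i)" if "i \<in> u" "i \<in> v" for i
    using integral_Psi1_times_Psi1[OF op, of i "j i" "k i"] that u by (auto simp: h_def g_def)
  show "(\<integral>\<omega>. Psi M X P u j \<omega> * Psi M X P v k \<omega> \<partial>M) = of_bool ((u, j) = (v, k))"
  proof (cases "(u, j) = (v, k)")
    case True
    have "(\<integral>\<omega>. h i (X i \<omega>) \<partial>M) = 1" if "i \<in> {1..N}" for i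
    proof (cases "i \<in> u")
      case False
      with True show ?thesis by (simp add: h_def g_def prob_space)
    qed (use True both in auto)
    with True show ?thesis
      unfolding factor by (simp add: prod.neutral)
  next
    case False
    have "\<exists>i\<in>{1..N}. (\<integral>\<omega>. h i (X i \<omega>) \<partial>M) = 0"
    proof (cases "u = v")
      case True
      with False have "j \<noteq> k" by simp
      with True obtain i where i: "i \<in> u" "j i \<noteq> k i"
        using u v by (meson PiE_ext)
      with True u both[of i] show ?thesis
        by auto
    next
      case False
      then obtain i where "i \<in> u \<and> i \<notin> v \<or> i \<in> v \<and> i \<notin> u"
        by blast
      then show ?thesis
      proof
        assume i: "i \<in> u \<and> i \<notin> v"
        with u have "i \<in> {1..N}" "1 \<le> j i"
          by (auto simp: PiE_iff)
        with i integral_Psi1[OF op, of i "j i"] show ?thesis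
          by (intro bexI[of _ i]) (simp_all add: h_def g_def)
      next
        assume i: "i \<in> v \<and> i \<notin> u"
        with v have "i \<in> {1..N}" "1 \<le> k i"
          by (auto simp: PiE_iff)
        with i integral_Psi1[OF op, of i "k i"] show ?thesis
          by (intro bexI[of _ i]) (simp_all add: h_def g_def)
      qed
    qed
    then have "(\<Prod>i\<in>{1..N}. \<integral>\<omega>. h i (X i \<omega>) \<partial>M) = 0"
      by (simp add: prod_zero_iff)
    then show ?thesis
      by (simp only: factor False of_bool_eq)
  qed
qed

section \<open>Polynomial dimensional decomposition\<close>

text \<open>
  The empty set is included so that the constant \<open>1\<close> has a label too; the only multi-index for it is
  the everywhere undefined function.
\<close>

definition PDD_index :: "nat \<Rightarrow> nat \<Rightarrow> nat \<Rightarrow> (nat set \<times> (nat \<Rightarrow> nat)) set" where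
  "PDD_index N S m = Sigma (insert {} (PDD_sets N S)) (PDD_multis m)"

lemma PDD_indexD:
  assumes "(u, j) \<in> PDD_index N S m"
  shows "u \<subseteq> {1..N}" "j \<in> u \<rightarrow>\<^sub>E {1..}"
  using assms by (auto simp: PDD_index_def PDD_sets_def PDD_multis_def)

lemma PDD_multis_empty: "PDD_multis m {} = {\<lambda>_. undefined}"
  by (auto simp: PDD_multis_def)

lemma finite_PDD_index: "finite (PDD_index N S m)"
  unfolding PDD_index_def
proof (intro finite_SigmaI)
  show "finite (insert {} (PDD_sets N S))"
    by (simp add: finite_PDD_sets)
  show "finite (PDD_multis m u)" if "u \<in> insert {} (PDD_sets N S)" for u
    using that by (intro finite_PDD_multis finite_subset[of u "{1..N}"]) (auto simp: PDD_sets_def)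
qed

lemma sum_PDD_index:
  "(\<Sum>k\<in>PDD_index N S m. F k) =
    F ({}, \<lambda>_. undefined) + (\<Sum>u\<in>PDD_sets N S. \<Sum>j\<in>PDD_multis m u. F (u, j))"
proof -
  have fin: "finite u" if "u \<in> PDD_sets N S" for u
    using that by (intro finite_subset[of u "{1..N}"]) (auto simp: PDD_sets_def)
  have "(\<Sum>k\<in>PDD_index N S m. F k) =
      (\<Sum>u\<in>insert {} (PDD_sets N S). \<Sum>j\<in>PDD_multis m u. F (u, j))"
    unfolding PDD_index_def
    by (subst sum.Sigma) (auto simp: finite_PDD_sets intro!: finite_PDD_multis fin)
  also have "\<dots> = (\<Sum>j\<in>PDD_multis m {}. F ({}, j)) +
      (\<Sum>u\<in>PDD_sets N S. \<Sum>j\<in>PDD_multis m u. F (u, j))"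
    by (subst sum.insert) (auto simp: finite_PDD_sets PDD_sets_def)
  finally show ?thesis
    by (simp add: PDD_multis_empty)
qed

lemma Psi_empty: "Psi M X P {} j = (\<lambda>_. 1)"
  by (simp add: Psi_def fun_eq_iff)

lemma (in prob_space) orthonormal_family_Psi:
  assumes op: "orthogonal_polys M N X P" and ind: "indep_vars (\<lambda>_. borel) X {1..N}"
  shows "orthonormal_family M (\<lambda>(u, j). Psi M X P u j) (PDD_index N S m)"
proof -
  have meas: "Psi M X P u j \<in> borel_measurable M" if "u \<subseteq> {1..N}" for u j
  proof -
    have "(\<lambda>\<omega>. Psi1 M X P i (j i) (X i \<omega>)) \<in> borel_measurable M" if "i \<in> u" for i
      using Psi1_in_L2[OF op, of i "j i"] ind that \<open>u \<subseteq> {1..N}\<close>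
      by (auto simp: L2_def indep_vars_def)
    then show ?thesis
      unfolding Psi_def[abs_def] by (intro borel_measurable_prod)
  qed
  have "Psi M X P u j \<in> L2 M" if "(u, j) \<in> PDD_index N S m" for u j
    using integral_Psi_times_Psi(1)[OF op ind PDD_indexD[OF that] PDD_indexD[OF that]]
      meas[OF PDD_indexD(1)[OF that]]
    by (simp add: L2_def power2_eq_square)
  moreover have "(\<integral>\<omega>. Psi M X P u j \<omega> * Psi M X P v k \<omega> \<partial>M) = of_bool ((u, j) = (v, k))"
    if "(u, j) \<in> PDD_index N S m" "(v, k) \<in> PDD_index N S m" for u j v k
    using integral_Psi_times_Psi(2)[OF op ind PDD_indexD[OF that(1)] PDD_indexD[OF that(2)]] .
  ultimately show ?thesis
    unfolding orthonormal_family_def by fast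
qed

lemma sum_fun_apply: "(\<Sum>k\<in>K. (F k :: 'w \<Rightarrow> 'b::comm_monoid_add)) \<omega> = (\<Sum>k\<in>K. F k \<omega>)"
  by (induction K rule: infinite_finite_induct) auto

text \<open>
  Choosing a scalar on each line turns a sum of elements of the lines into a single coefficient
  family on the labels. The individual coefficients are kept since directness speaks about each
  summand.
\<close>

lemma PDD_summands_coefficients:
  assumes v0: "v0 \<in> rfun.span {\<lambda>_. 1}"
    and v: "\<forall>u\<in>PDD_sets N S. \<forall>j\<in>PDD_multis m u. v u j \<in> rfun.span {Psi M X P u j}"
  shows "\<exists>c. v0 = (\<lambda>_. c ({}, \<lambda>_. undefined)) \<and>
    (\<forall>u\<in>PDD_sets N S. \<forall>j\<in>PDD_multis m u. v u j = (\<lambda>\<omega>. c (u, j) * Psi M X P u j \<omega>)) \<and>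
    v0 + (\<Sum>u\<in>PDD_sets N S. \<Sum>j\<in>PDD_multis m u. v u j) =
      (\<lambda>\<omega>. \<Sum>k\<in>PDD_index N S m. c k * (case k of (u, j) \<Rightarrow> Psi M X P u j) \<omega>)"
proof -
  obtain c0 where c0: "v0 = (\<lambda>_. c0)"
    using v0 by (auto simp: rfun.span_singleton)
  have "\<forall>u j. \<exists>b. u \<in> PDD_sets N S \<longrightarrow> j \<in> PDD_multis m u \<longrightarrow> v u j = (\<lambda>\<omega>. b * Psi M X P u j \<omega>)"
    using v by (fastforce simp: rfun.span_singleton)
  then obtain b where b: "\<And>u j. u \<in> PDD_sets N S \<Longrightarrow> j \<in> PDD_multis m u \<Longrightarrow>
      v u j = (\<lambda>\<omega>. b u j * Psi M X P u j \<omega>)"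
    by metis
  define c where "c = (\<lambda>(u, j). if u = {} then c0 else b u j)"
  have cv: "v u j = (\<lambda>\<omega>. c (u, j) * Psi M X P u j \<omega>)"
    if "u \<in> PDD_sets N S" "j \<in> PDD_multis m u" for u j
    using b[OF that] that by (auto simp: c_def PDD_sets_def)
  have "(v0 + (\<Sum>u\<in>PDD_sets N S. \<Sum>j\<in>PDD_multis m u. v u j)) \<omega> =
      (\<Sum>k\<in>PDD_index N S m. c k * (case k of (u, j) \<Rightarrow> Psi M X P u j) \<omega>)" for \<omega>
    by (simp add: sum_PDD_index sum_fun_apply c0 Psi_empty cv cong: sum.cong) (simp add: c_def)
  then show ?thesis
    using c0 cv by (intro exI[of _ c]) (auto simp: c_def)
qed

lemma PDD_spaceI:
  fixes X :: "nat \<Rightarrow> 'w \<Rightarrow> real"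
  shows "(\<lambda>\<omega>. \<Sum>k\<in>PDD_index N S m. c k * (case k of (u, j) \<Rightarrow> Psi M X P u j) \<omega>) \<in> PDD_space M N X P S m"
proof -
  define v0 :: "'w \<Rightarrow> real" where "v0 = (\<lambda>_. c ({}, \<lambda>_. undefined))"
  define v where "v u j = (\<lambda>\<omega>. c (u, j) * Psi M X P u j \<omega>)" for u j
  have "(\<lambda>\<omega>. \<Sum>k\<in>PDD_index N S m. c k * (case k of (u, j) \<Rightarrow> Psi M X P u j) \<omega>) =
      v0 + (\<Sum>u\<in>PDD_sets N S. \<Sum>j\<in>PDD_multis m u. v u j)"
    by (simp add: fun_eq_iff sum_PDD_index sum_fun_apply v0_def v_def Psi_empty)
  moreover have "v0 \<in> rfun.span {\<lambda>_. 1}" "v u j \<in> rfun.span {Psi M X P u j}" for u j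
    by (auto simp: v0_def v_def rfun.span_singleton)
  ultimately show ?thesis
    unfolding PDD_space_def by blast
qed

lemma PDD_spaceE:
  assumes "g \<in> PDD_space M N X P S m"
  obtains c where
    "g = (\<lambda>\<omega>. \<Sum>k\<in>PDD_index N S m. c k * (case k of (u, j) \<Rightarrow> Psi M X P u j) \<omega>)"
proof -
  obtain v0 v where g: "g = v0 + (\<Sum>u\<in>PDD_sets N S. \<Sum>j\<in>PDD_multis m u. v u j)"
    and v: "v0 \<in> rfun.span {\<lambda>_. 1}"
      "\<forall>u\<in>PDD_sets N S. \<forall>j\<in>PDD_multis m u. v u j \<in> rfun.span {Psi M X P u j}"
    using assms unfolding PDD_space_def by blast
  obtain c where "v0 + (\<Sum>u\<in>PDD_sets N S. \<Sum>j\<in>PDD_multis m u. v u j) =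
      (\<lambda>\<omega>. \<Sum>k\<in>PDD_index N S m. c k * (case k of (u, j) \<Rightarrow> Psi M X P u j) \<omega>)"
    using PDD_summands_coefficients[OF v] by (elim exE conjE) (rule that)
  with g show ?thesis
    by (intro that) simp
qed

text \<open>The mean of \<open>Y\<close> is its Fourier coefficient along the constant \<open>\<Psi>\<^sub>\<emptyset> = 1\<close>.\<close>

lemma PDD_approx_Fourier_sum:
  "PDD_approx M N X P S m Y \<omega> =
    (\<Sum>k\<in>PDD_index N S m. (\<integral>\<omega>'. Y \<omega>' * (case k of (u, j) \<Rightarrow> Psi M X P u j) \<omega>' \<partial>M) *
      (case k of (u, j) \<Rightarrow> Psi M X P u j) \<omega>)"
  by (simp add: PDD_approx_def PDD_coeff_def sum_PDD_index Psi_empty)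

lemma input_vec_measurable:
  assumes "\<And>i. i \<in> {1..N} \<Longrightarrow> X i \<in> borel_measurable M"
    and "\<And>i \<omega>. i \<in> {1..N} \<Longrightarrow> \<omega> \<in> space M \<Longrightarrow> X i \<omega> \<in> A i"
  shows "input_vec N X \<in> M \<rightarrow>\<^sub>M (\<Pi>\<^sub>M i\<in>{1..N}. restrict_space borel (A i))"
  unfolding input_vec_def[abs_def]
  using assms by (intro measurable_restrict measurable_restrict_space2) auto

theorem corollary4p3:
  fixes M :: "'w measure" and N S m :: nat
    and X :: "nat \<Rightarrow> 'w \<Rightarrow> real" and A :: "nat \<Rightarrow> real set" and f :: "nat \<Rightarrow> real \<Rightarrow> real"
    and P :: "nat \<Rightarrow> nat \<Rightarrow> real poly" and y :: "(nat \<Rightarrow> real) \<Rightarrow> real"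
  assumes "prob_space M" and "complete_measure M"
    and "1 \<le> N"
    and "\<forall>i\<in>{1..N}. \<forall>\<omega>\<in>space M. X i \<omega> \<in> A i"
    and "assumption_A M N X A f"
    and "assumption_B M N X A f"
    and "orthogonal_polys M N X P"
    and "y \<in> borel_measurable (\<Pi>\<^sub>M i\<in>{1..N}. restrict_space borel (A i))"
    and "integrable M (\<lambda>\<omega>. (y (input_vec N X \<omega>))\<^sup>2)"
    and "S \<le> N" and "S \<le> m"
  shows "PDD_space M N X P S m \<subseteq> L2 M \<and>
    PDD_sum_direct M N X P S m \<and>
    (\<integral>\<omega>. (y (input_vec N X \<omega>) - PDD_approx M N X P S m (\<lambda>\<omega>'. y (input_vec N X \<omega>')) \<omega>)\<^sup>2 \<partial>M) =
    (INF ybar\<in>PDD_space M N X P S m. \<integral>\<omega>. (y (input_vec N X \<omega>) - ybar \<omega>)\<^sup>2 \<partial>M)"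
proof (intro conjI)
  interpret prob_space M by fact
  let ?e = "\<lambda>(u, j). Psi M X P u j"
  let ?K = "PDD_index N S m"
  let ?Y = "\<lambda>\<omega>. y (input_vec N X \<omega>)"
  have ind: "indep_vars (\<lambda>_. borel) X {1..N}"
    using assms(5) by (simp add: assumption_A_def)
  note on = orthonormal_family_Psi[OF assms(7) ind, of S m]
  note K = finite_PDD_index[of N S m]
  have "input_vec N X \<in> M \<rightarrow>\<^sub>M (\<Pi>\<^sub>M i\<in>{1..N}. restrict_space borel (A i))"
    using ind assms(4) by (intro input_vec_measurable) (auto simp: indep_vars_def)
  with assms(8,9) have Y: "?Y \<in> L2 M"
    by (simp add: L2_def)
  show "PDD_space M N X P S m \<subseteq> L2 M"
  proof
    fix g assume "g \<in> PDD_space M N X P S m"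
    then obtain c where "g = (\<lambda>\<omega>. \<Sum>k\<in>?K. c k * ?e k \<omega>)"
      by (rule PDD_spaceE)
    with on K show "g \<in> L2 M"
      by (auto simp: orthonormal_family_def intro!: L2_sum)
  qed
  show "PDD_sum_direct M N X P S m"
    unfolding PDD_sum_direct_def
  proof (rule allI, rule allI, rule impI, rule impI, rule impI)
    fix v0 v
    assume v: "v0 \<in> rfun.span {\<lambda>_. 1}"
        "\<forall>u\<in>PDD_sets N S. \<forall>j\<in>PDD_multis m u. v u j \<in> rfun.span {Psi M X P u j}"
      and zero: "AE \<omega> in M. (v0 + (\<Sum>u\<in>PDD_sets N S. \<Sum>j\<in>PDD_multis m u. v u j)) \<omega> = 0"
    obtain c where c: "v0 = (\<lambda>_. c ({}, \<lambda>_. undefined))"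
        "\<forall>u\<in>PDD_sets N S. \<forall>j\<in>PDD_multis m u.
          v u j = (\<lambda>\<omega>. c (u, j) * Psi M X P u j \<omega>)"
        "v0 + (\<Sum>u\<in>PDD_sets N S. \<Sum>j\<in>PDD_multis m u. v u j) = (\<lambda>\<omega>. \<Sum>k\<in>?K. c k * ?e k \<omega>)"
      using PDD_summands_coefficients[OF v] by (elim exE conjE) (rule that)
    have "c k = 0" if "k \<in> ?K" for k
      using orthonormal_family_independent[OF on K _ that, of c] zero unfolding c(3) by blast
    then have "c ({}, \<lambda>_. undefined) = 0"
      and "\<And>u j. u \<in> PDD_sets N S \<Longrightarrow> j \<in> PDD_multis m u \<Longrightarrow> c (u, j) = 0"
      by (auto simp: PDD_index_def PDD_multis_empty)
    then show "(AE \<omega> in M. v0 \<omega> = 0) \<and>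
        (\<forall>u\<in>PDD_sets N S. \<forall>j\<in>PDD_multis m u. AE \<omega> in M. v u j \<omega> = 0)"
      using c(1,2) by simp
  qed
  show "(\<integral>\<omega>. (?Y \<omega> - PDD_approx M N X P S m ?Y \<omega>)\<^sup>2 \<partial>M) =
      (INF ybar\<in>PDD_space M N X P S m. \<integral>\<omega>. (?Y \<omega> - ybar \<omega>)\<^sup>2 \<partial>M)"
  proof (rule cInf_eq_minimum[symmetric])
    have "PDD_approx M N X P S m ?Y \<in> PDD_space M N X P S m"
      unfolding PDD_approx_Fourier_sum[abs_def] by (rule PDD_spaceI)
    then show "(\<integral>\<omega>. (?Y \<omega> - PDD_approx M N X P S m ?Y \<omega>)\<^sup>2 \<partial>M) \<in>
        (\<lambda>ybar. \<integral>\<omega>. (?Y \<omega> - ybar \<omega>)\<^sup>2 \<partial>M) ` PDD_space M N X P S m"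
      by blast
  next
    fix d assume "d \<in> (\<lambda>ybar. \<integral>\<omega>. (?Y \<omega> - ybar \<omega>)\<^sup>2 \<partial>M) ` PDD_space M N X P S m"
    then obtain g where g: "g \<in> PDD_space M N X P S m" and d: "d = (\<integral>\<omega>. (?Y \<omega> - g \<omega>)\<^sup>2 \<partial>M)"
      by blast
    from g obtain c where "g = (\<lambda>\<omega>. \<Sum>k\<in>?K. c k * ?e k \<omega>)"
      by (rule PDD_spaceE)
    with d show "(\<integral>\<omega>. (?Y \<omega> - PDD_approx M N X P S m ?Y \<omega>)\<^sup>2 \<partial>M) \<le> d"
      using orthonormal_family_best_approximation[OF on K Y, of c]
      by (simp add: PDD_approx_Fourier_sum)
  qed
qed

end
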